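(* Let $q$ be an odd prime power. For $b\in\mathrm{GF}(q)$ let $P_b$ denote the conic of equation $yz=x^2+bz^2$ in $\mathrm{PG}(2,q)$. For a nonempty subset $B\subseteq\mathrm{GF}(q)$ consider $$X(B):=\bigcup_{b\in B}P_b.$$ Then $X(B)$ is regular of pointed type.
   Context: $P_b$ is regarded as the set of its points in $\mathrm{PG}(2,q)$, with homogeneous coordinates $(x:y:z)$. A line is a $k$-secant of a point set $X$ if it meets $X$ in exactly $k$ points. A point set $X$ of $\mathrm{PG}(2,q)$ is regular of pointed type $[t;m_1,\ldots,m_h]$, where $t>0$, if there are a distinguished point $P_0\in X$ and a line $\ell_0$ with $\ell_0\cap X=\{P_0\}$ such that: (i) every line not through $P_0$ is an $m_i$-secant of $X$ for some $i\in\{1,\ldots,h\}$; (ii) for each $i$, the number of $m_i$-secants of $X$ incident with $P$ is the same for each $P\in\ell_0\setminus\{P_0\}$; (iii) all lines incident with $P_0$ other than $\ell_0$ are $(t+1)$-secants of $X$. "Regular of pointed type" means regular of pointed type $[t;m_1,\ldots,m_h]$ for some such parameters. The distinguished point is always taken to be $P_0=(\infty)=(0:1:0)$ and $\ell_0$ is the line at infinity $z=0$. *)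

theory Defs
  imports "HOL-Library.Cardinality"
begin

text \<open>
  The plane PG(2,q) over a finite field \<open>'a\<close> with q elements: a point is the class of a
  nonzero coordinate triple up to nonzero scalars, and a line is identified with the set of
  its points.
\<close>

type_synonym 'a pg_point = "('a \<times> 'a \<times> 'a) set"

definition hpoint :: "'a::field \<Rightarrow> 'a \<Rightarrow> 'a \<Rightarrow> 'a pg_point" where
  "hpoint x y z = {(c * x, c * y, c * z) |c. c \<noteq> 0}"

definition pg_points :: "'a::field pg_point set" where
  "pg_points = {hpoint x y z |x y z. (x, y, z) \<noteq> (0, 0, 0)}"

definition pg_line :: "'a::field \<Rightarrow> 'a \<Rightarrow> 'a \<Rightarrow> 'a pg_point set" where
  "pg_line u v w =
     {hpoint x y z |x y z. (x, y, z) \<noteq> (0, 0, 0) \<and> u * x + v * y + w * z = 0}"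

definition pg_lines :: "'a::field pg_point set set" where
  "pg_lines = {pg_line u v w |u v w. (u, v, w) \<noteq> (0, 0, 0)}"

definition secant :: "nat \<Rightarrow> 'a::{field,finite} pg_point set \<Rightarrow> 'a pg_point set \<Rightarrow> bool" where
  "secant k X l \<longleftrightarrow> l \<in> pg_lines \<and> card (l \<inter> X) = k"

text \<open>
  \<open>ms\<close> lists the parameters \<open>m\<^sub>1, \<dots>, m\<^sub>h\<close>.  In the count of \<open>m\<close>-secants the line \<open>l0\<close>
  is itself a 1-secant through every \<open>P\<close>, so it contributes equally to all the counts.
\<close>

definition regular_pointed ::
  "'a::{field,finite} pg_point \<Rightarrow> 'a pg_point set \<Rightarrow> nat \<Rightarrow> nat list \<Rightarrow> 'a pg_point set \<Rightarrow> bool"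
where
  "regular_pointed P0 l0 t ms X \<longleftrightarrow>
     X \<subseteq> pg_points \<and> t > 0 \<and> P0 \<in> X \<and> l0 \<in> pg_lines \<and> l0 \<inter> X = {P0} \<and>
     (\<forall>l\<in>pg_lines. P0 \<notin> l \<longrightarrow> (\<exists>m\<in>set ms. secant m X l)) \<and>
     (\<forall>m\<in>set ms. \<exists>n. \<forall>P\<in>l0 - {P0}. card {l. secant m X l \<and> P \<in> l} = n) \<and>
     (\<forall>l\<in>pg_lines. P0 \<in> l \<and> l \<noteq> l0 \<longrightarrow> secant (t + 1) X l)"

definition P_infinity :: "'a::field pg_point" where
  "P_infinity = hpoint 0 1 0"

definition line_infinity :: "'a::field pg_point set" where
  "line_infinity = pg_line 0 0 1"

text \<open>The distinguished point and line are fixed to be (0:1:0) and \<open>z = 0\<close>.\<close>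

definition regular_of_pointed_type :: "'a::{field,finite} pg_point set \<Rightarrow> bool" where
  "regular_of_pointed_type X \<longleftrightarrow>
     (\<exists>t ms. regular_pointed P_infinity line_infinity t ms X)"

definition conic :: "'a::field \<Rightarrow> 'a pg_point set" where
  "conic b = {hpoint x y z |x y z. (x, y, z) \<noteq> (0, 0, 0) \<and> y * z = x\<^sup>2 + b * z\<^sup>2}"

definition conic_union :: "'a::field set \<Rightarrow> 'a pg_point set" where
  "conic_union B = (\<Union>b\<in>B. conic b)"

text \<open>The defining equations do not depend on the chosen coordinates.\<close>

lemma hpoint_eq_iff:
  "hpoint x y z = hpoint x' y' z' \<longleftrightarrow>
     (\<exists>c. c \<noteq> 0 \<and> x' = c * x \<and> y' = c * y \<and> z' = c * z)"
  for x y z :: "'a::field"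
proof
  assume eq: "hpoint x y z = hpoint x' y' z'"
  have "(x', y', z') \<in> hpoint x' y' z'"
    unfolding hpoint_def by (auto intro!: exI[of _ 1])
  then show "\<exists>c. c \<noteq> 0 \<and> x' = c * x \<and> y' = c * y \<and> z' = c * z"
    unfolding eq[symmetric] unfolding hpoint_def by auto
next
  assume "\<exists>c. c \<noteq> 0 \<and> x' = c * x \<and> y' = c * y \<and> z' = c * z"
  then obtain c where c: "c \<noteq> 0" "x' = c * x" "y' = c * y" "z' = c * z" by blast
  have "(d * x, d * y, d * z) \<in> hpoint x' y' z'" if "d \<noteq> 0" for d
    unfolding hpoint_def using c that by (auto intro!: exI[of _ "d / c"])
  moreover have "(d * x', d * y', d * z') \<in> hpoint x y z" if "d \<noteq> 0" for d
    unfolding hpoint_def using c that by (auto intro!: exI[of _ "d * c"])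
  ultimately show "hpoint x y z = hpoint x' y' z'"
    unfolding hpoint_def by blast
qed

lemma hpoint_in_line_iff:
  assumes "(x, y, z) \<noteq> (0, 0, 0)"
  shows "hpoint x y z \<in> pg_line u v w \<longleftrightarrow> u * x + v * y + w * z = 0"
proof
  assume "hpoint x y z \<in> pg_line u v w"
  then obtain c where c: "c \<noteq> 0" "u * (c * x) + v * (c * y) + w * (c * z) = 0"
    unfolding pg_line_def by (auto simp: hpoint_eq_iff)
  then have "c * (u * x + v * y + w * z) = 0" by (simp add: algebra_simps)
  with c(1) show "u * x + v * y + w * z = 0" by simp
next
  assume "u * x + v * y + w * z = 0"
  with assms show "hpoint x y z \<in> pg_line u v w" unfolding pg_line_def by blast
qed

lemma hpoint_in_conic_iff:
  assumes "(x, y, z) \<noteq> (0, 0, 0)"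
  shows "hpoint x y z \<in> conic b \<longleftrightarrow> y * z = x\<^sup>2 + b * z\<^sup>2"
proof
  assume "hpoint x y z \<in> conic b"
  then obtain c where c: "c \<noteq> 0" "(c * y) * (c * z) = (c * x)\<^sup>2 + b * (c * z)\<^sup>2"
    unfolding conic_def by (auto simp: hpoint_eq_iff)
  then have "c\<^sup>2 * (y * z) = c\<^sup>2 * (x\<^sup>2 + b * z\<^sup>2)"
    by (simp add: algebra_simps power2_eq_square)
  with c(1) show "y * z = x\<^sup>2 + b * z\<^sup>2" by simp
next
  assume "y * z = x\<^sup>2 + b * z\<^sup>2"
  with assms show "hpoint x y z \<in> conic b" unfolding conic_def by blast
qed

end

theory Submission
  imports Defs
begin

text \<open>
  In the affine part \<open>z = 1\<close> the union of conics is the set of the points \<open>(x, x\<^sup>2 + b)\<close>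
  with \<open>b \<in> B\<close>, and its only point at infinity is \<open>(0:1:0)\<close>.  A line through \<open>(0:1:0)\<close> other
  than the line at infinity has an affine equation \<open>x = c\<close>, so it carries one further point
  for each \<open>b \<in> B\<close>; this gives \<open>t = card B\<close> (\<open>vertical_line_secant\<close>).

  The uniform distribution of the secants over the points at infinity is a matter of
  symmetry.  The maps \<open>(x, y) \<mapsto> (x + s, y + 2 s x + s\<^sup>2)\<close> extend to collineations that
  stabilise every conic \<open>y z = x\<^sup>2 + b z\<^sup>2\<close>, because \<open>y - x\<^sup>2\<close> is invariant
  (\<open>shear_conic_union\<close>).  They form a group that moves the point \<open>(1:m:0)\<close> to \<open>(1:m+2s:0)\<close>,
  and so, as 2 is invertible in odd order, acts transitively on the points of the line
  at infinity other than \<open>(0:1:0)\<close>.  A collineation that stabilises \<open>X\<close> carries the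
  \<open>m\<close>-secants through a point bijectively to the \<open>m\<close>-secants through its image, so for every
  \<open>m\<close> the number of \<open>m\<close>-secants is the same at all these points.
\<close>

section \<open>The shears that stabilise the conics\<close>

definition shear_coords :: "'a::field \<Rightarrow> 'a \<times> 'a \<times> 'a \<Rightarrow> 'a \<times> 'a \<times> 'a" where
  "shear_coords s = (\<lambda>(x, y, z). (x + s * z, y + 2 * s * x + s\<^sup>2 * z, z))"

definition shear :: "'a::field \<Rightarrow> 'a pg_point \<Rightarrow> 'a pg_point" where
  "shear s = image (shear_coords s)"

lemma shear_hpoint:
  "shear s (hpoint x y z) = hpoint (x + s * z) (y + 2 * s * x + s\<^sup>2 * z) z"
proof -
  have "shear_coords s (c * x, c * y, c * z)
      = (c * (x + s * z), c * (y + 2 * s * x + s\<^sup>2 * z), c * z)" for c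
    by (simp add: shear_coords_def algebra_simps)
  then show ?thesis
    unfolding shear_def hpoint_def by (auto simp: image_iff) metis+
qed

lemma shear_coords_eq_0_iff: "shear_coords s p = (0, 0, 0) \<longleftrightarrow> p = (0, 0, 0)"
  by (cases p) (auto simp: shear_coords_def)

lemma shear_minus_shear: "shear (- s) (shear s P) = P"
proof -
  have "shear_coords (- s) (shear_coords s p) = p" for p
    by (cases p) (simp add: shear_coords_def algebra_simps power2_eq_square)
  then show ?thesis
    by (simp add: shear_def image_image)
qed

lemma inj_shear: "inj (shear s)"
  by (metis injI shear_minus_shear)

text \<open>
  One inclusion for all parameters is enough to identify an image under a shear, since the
  inverse of a shear is a shear.
\<close>

lemma shear_image_eqI:
  assumes "shear s ` X \<subseteq> Y" and "shear (- s) ` Y \<subseteq> X"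
  shows "shear s ` X = Y"
proof
  show "Y \<subseteq> shear s ` X"
  proof
    fix P assume "P \<in> Y"
    with assms(2) have "shear (- s) P \<in> X" by blast
    moreover have "P = shear s (shear (- s) P)"
      using shear_minus_shear[of "- s" P] by simp
    ultimately show "P \<in> shear s ` X" by blast
  qed
qed (fact assms(1))

lemma shear_pg_line:
  "shear s ` pg_line u v w = pg_line (u - 2 * s * v) v (w - s * u + s\<^sup>2 * v)"
proof -
  have sub: "shear r ` pg_line a b c \<subseteq> pg_line (a - 2 * r * b) b (c - r * a + r\<^sup>2 * b)"
    for r a b c :: 'a
  proof (rule image_subsetI)
    fix P assume "P \<in> pg_line a b c"
    then obtain x y z where P: "P = hpoint x y z" "(x, y, z) \<noteq> (0, 0, 0)"
      and eq: "a * x + b * y + c * z = 0"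
      unfolding pg_line_def by blast
    have "(a - 2 * r * b) * (x + r * z) + b * (y + 2 * r * x + r\<^sup>2 * z)
        + (c - r * a + r\<^sup>2 * b) * z = a * x + b * y + c * z"
      by (simp add: algebra_simps power2_eq_square)
    moreover have "(x + r * z, y + 2 * r * x + r\<^sup>2 * z, z) \<noteq> (0, 0, 0)"
      using shear_coords_eq_0_iff[of r "(x, y, z)"] P(2) by (simp add: shear_coords_def)
    ultimately show "shear r P \<in> pg_line (a - 2 * r * b) b (c - r * a + r\<^sup>2 * b)"
      using P(1) eq by (simp add: shear_hpoint hpoint_in_line_iff)
  qed
  show ?thesis
  proof (rule shear_image_eqI[OF sub])
    show "shear (- s) ` pg_line (u - 2 * s * v) v (w - s * u + s\<^sup>2 * v) \<subseteq> pg_line u v w"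
      using sub[of "- s" "u - 2 * s * v" v "w - s * u + s\<^sup>2 * v"]
      by (simp add: algebra_simps power2_eq_square)
  qed
qed

lemma shear_in_pg_lines:
  assumes "l \<in> pg_lines"
  shows "shear s ` l \<in> pg_lines"
proof -
  from assms obtain u v w where l: "l = pg_line u v w" "(u, v, w) \<noteq> (0, 0, 0)"
    unfolding pg_lines_def by blast
  from l(2) have "(u - 2 * s * v, v, w - s * u + s\<^sup>2 * v) \<noteq> (0, 0, 0)" by auto
  then show ?thesis unfolding l(1) shear_pg_line pg_lines_def by blast
qed

lemma shear_conic_union: "shear s ` conic_union B = conic_union B"
proof -
  have sub: "shear r ` conic_union B \<subseteq> conic_union B" for r
  proof (rule image_subsetI)
    fix P assume "P \<in> conic_union B"
    then obtain b x y z where P: "P = hpoint x y z" "(x, y, z) \<noteq> (0, 0, 0)"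
      and b: "b \<in> B" and eq: "y * z = x\<^sup>2 + b * z\<^sup>2"
      unfolding conic_union_def conic_def by blast
    have "(y + 2 * r * x + r\<^sup>2 * z) * z - (x + r * z)\<^sup>2 = y * z - x\<^sup>2"
      by (simp add: algebra_simps power2_eq_square)
    with eq have "(y + 2 * r * x + r\<^sup>2 * z) * z = (x + r * z)\<^sup>2 + b * z\<^sup>2"
      by (simp add: algebra_simps)
    moreover have "(x + r * z, y + 2 * r * x + r\<^sup>2 * z, z) \<noteq> (0, 0, 0)"
      using shear_coords_eq_0_iff[of r "(x, y, z)"] P(2) by (simp add: shear_coords_def)
    ultimately have "shear r P \<in> conic b"
      unfolding P(1) shear_hpoint by (simp add: hpoint_in_conic_iff)
    with b show "shear r P \<in> conic_union B" unfolding conic_union_def by blast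
  qed
  show ?thesis by (rule shear_image_eqI[OF sub sub])
qed

section \<open>Counting secants at the points at infinity\<close>

lemma secant_shear:
  assumes "shear s ` X = X" and "secant m X l"
  shows "secant m X (shear s ` l)"
proof -
  have "shear s ` l \<inter> X = shear s ` (l \<inter> X)"
    using assms(1) image_Int[OF inj_shear, of s l X] by simp
  then have "card (shear s ` l \<inter> X) = card (l \<inter> X)"
    using card_image[OF inj_on_subset[OF inj_shear]] by simp
  with assms(2) show ?thesis
    unfolding secant_def by (simp add: shear_in_pg_lines)
qed

text \<open>
  The inverse of the shear gives the same inequality in the opposite direction, so
  \<open>\<le>\<close> is all that has to be shown.
\<close>

lemma card_secants_le_shear:
  fixes X :: "'a::{field,finite} pg_point set"
  assumes "shear s ` X = X"
  shows "card {l. secant m X l \<and> P \<in> l} \<le> card {l. secant m X l \<and> shear s P \<in> l}"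
proof (rule card_inj_on_le)
  show "inj_on (image (shear s)) {l. secant m X l \<and> P \<in> l}"
    by (intro inj_onI) (simp add: inj_image_eq_iff[OF inj_shear])
  show "image (shear s) ` {l. secant m X l \<and> P \<in> l} \<subseteq> {l. secant m X l \<and> shear s P \<in> l}"
    using secant_shear[OF assms] by blast
qed simp

text \<open>
  If 2 vanished, translation by 1 would be an involution without fixed points, and the field
  would be a disjoint union of pairs.
\<close>

lemma two_neq_0_if_odd_card:
  assumes "odd CARD('a::{field,finite})"
  shows "(2::'a) \<noteq> 0"
proof
  assume two: "(2::'a) = 0"
  have add: "x + 1 + 1 = x" for x :: 'a
    using two by (simp add: add.assoc)
  define C where "C = (\<lambda>x::'a. {x, x + 1}) ` UNIV"
  have "2 * card C = card (\<Union>C)"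
  proof (rule card_partition)
    show "card c = 2" if "c \<in> C" for c
      using that by (auto simp: C_def)
    show "c \<inter> d = {}" if "c \<in> C" "d \<in> C" "c \<noteq> d" for c d
      using that by (auto simp: C_def add)
  qed simp_all
  moreover have "\<Union>C = UNIV" by (auto simp: C_def)
  ultimately have "CARD('a) = 2 * card C" by simp
  with assms show False by simp
qed

lemma point_at_infinity_cases:
  assumes "P \<in> line_infinity - {P_infinity}"
  obtains m where "P = hpoint 1 m 0"
proof -
  from assms obtain x y where P: "P = hpoint x y 0" "(x, y) \<noteq> (0, 0)"
    unfolding line_infinity_def pg_line_def by auto
  have "x \<noteq> 0"
  proof
    assume "x = 0"
    with P have "P = P_infinity"
      unfolding P_infinity_def by (auto simp: hpoint_eq_iff intro!: exI[of _ "1 / y"])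
    with assms show False by blast
  qed
  then have "P = hpoint 1 (y / x) 0"
    unfolding P(1) by (auto simp: hpoint_eq_iff intro!: exI[of _ "1 / x"])
  then show thesis by (rule that)
qed

lemma card_secants_at_infinity:
  fixes B :: "'a::{field,finite} set"
  assumes two: "(2::'a) \<noteq> 0"
    and "P \<in> line_infinity - {P_infinity}" and "Q \<in> line_infinity - {P_infinity}"
  shows "card {l. secant m (conic_union B) l \<and> P \<in> l}
       = card {l. secant m (conic_union B) l \<and> Q \<in> l}"
proof -
  have le: "card {l. secant m (conic_union B) l \<and> P \<in> l}
      \<le> card {l. secant m (conic_union B) l \<and> Q \<in> l}"
    if P: "P \<in> line_infinity - {P_infinity}" and Q: "Q \<in> line_infinity - {P_infinity}" for P Q
  proof -
    obtain a where a: "P = hpoint 1 a 0" using P by (rule point_at_infinity_cases)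
    obtain c where c: "Q = hpoint 1 c 0" using Q by (rule point_at_infinity_cases)
    have "2 * ((c - a) / 2) = c - a" using two by simp
    then have "shear ((c - a) / 2) P = Q"
      unfolding a c shear_hpoint by (simp del: times_divide_eq_right)
    then show ?thesis
      using card_secants_le_shear[OF shear_conic_union, of m B P "(c - a) / 2"] by simp
  qed
  show ?thesis using le assms(2,3) by (intro antisym) auto
qed

section \<open>Lines through the distinguished point\<close>

lemma conic_union_points:
  assumes "B \<noteq> {}"
  shows "conic_union B = insert P_infinity {hpoint x (x\<^sup>2 + b) 1 |x b. b \<in> B}"
proof (intro equalityI subsetI)
  fix P assume "P \<in> conic_union B"
  then obtain b x y z where P: "P = hpoint x y z" "(x, y, z) \<noteq> (0, 0, 0)"
    and b: "b \<in> B" and eq: "y * z = x\<^sup>2 + b * z\<^sup>2"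
    unfolding conic_union_def conic_def by blast
  show "P \<in> insert P_infinity {hpoint x (x\<^sup>2 + b) 1 |x b. b \<in> B}"
  proof (cases "z = 0")
    case True
    with eq P have "P = P_infinity"
      unfolding P_infinity_def by (auto simp: hpoint_eq_iff intro!: exI[of _ "1 / y"])
    then show ?thesis by simp
  next
    case False
    with eq have "y / z = (x / z)\<^sup>2 + b"
      by (simp add: field_simps power2_eq_square)
    with False have "P = hpoint (x / z) ((x / z)\<^sup>2 + b) 1"
      unfolding P(1) by (auto simp: hpoint_eq_iff intro!: exI[of _ "1 / z"])
    with b show ?thesis by blast
  qed
next
  fix P assume "P \<in> insert P_infinity {hpoint x (x\<^sup>2 + b) 1 |x b. b \<in> B}"
  with assms show "P \<in> conic_union B"
    by (auto simp: P_infinity_def conic_union_def hpoint_in_conic_iff)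
qed

lemma line_infinity_Int_conic_union:
  assumes "B \<noteq> {}"
  shows "line_infinity \<inter> conic_union B = {P_infinity}"
  unfolding conic_union_points[OF assms]
  by (auto simp: line_infinity_def P_infinity_def hpoint_in_line_iff)

lemma vertical_line_secant:
  fixes B :: "'a::{field,finite} set"
  assumes "B \<noteq> {}" and l: "l \<in> pg_lines" "P_infinity \<in> l" "l \<noteq> line_infinity"
  shows "secant (card B + 1) (conic_union B) l"
proof -
  obtain u v w where uvw: "l = pg_line u v w" "(u, v, w) \<noteq> (0, 0, 0)"
    using l(1) unfolding pg_lines_def by blast
  have v: "v = 0"
    using l(2) unfolding uvw(1) P_infinity_def by (simp add: hpoint_in_line_iff)
  have u: "u \<noteq> 0"
  proof
    assume "u = 0"
    with uvw v have "l = line_infinity"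
      unfolding line_infinity_def pg_line_def by simp
    with l(3) show False by contradiction
  qed
  define c where "c = - w / u"
  define f where "f = (\<lambda>b. hpoint c (c\<^sup>2 + b) 1)"
  have on_line: "hpoint x y 1 \<in> l \<longleftrightarrow> x = c" for x y
    using u unfolding uvw(1) v c_def
    by (auto simp: hpoint_in_line_iff field_simps eq_neg_iff_add_eq_0)
  have "l \<inter> conic_union B = insert P_infinity (f ` B)"
    unfolding conic_union_points[OF assms(1)] using l(2) by (auto simp: on_line f_def)
  moreover have "inj_on f B"
    by (auto simp: inj_on_def f_def hpoint_eq_iff)
  moreover have "P_infinity \<notin> f ` B"
    by (auto simp: f_def P_infinity_def hpoint_eq_iff)
  ultimately have "card (l \<inter> conic_union B) = card B + 1"
    by (simp add: card_image)
  with l(1) show ?thesis unfolding secant_def by simp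
qed

theorem theorem2p5:
  fixes B :: "'a::{field,finite} set"
  assumes "odd CARD('a)"
    and "B \<noteq> {}"
  shows "regular_of_pointed_type (conic_union B)"
proof -
  let ?X = "conic_union B"
  \<comment> \<open>All conceivable intersection numbers may be listed, because the counts at the points
    at infinity agree for every \<open>m\<close>; a number that no line attains gives the count 0.\<close>
  let ?ms = "[0..<Suc (card ?X)]"
  have two: "(2::'a) \<noteq> 0" using assms(1) by (rule two_neq_0_if_odd_card)
  have "regular_pointed P_infinity line_infinity (card B) ?ms ?X"
    unfolding regular_pointed_def
  proof (intro conjI ballI impI)
    show "?X \<subseteq> pg_points"
      unfolding conic_union_def conic_def pg_points_def by blast
    show "card B > 0" using assms(2) by (simp add: card_gt_0_iff)
    show "P_infinity \<in> ?X" using conic_union_points[OF assms(2)] by simp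
    show "line_infinity \<in> pg_lines"
      unfolding line_infinity_def pg_lines_def by force
    show "line_infinity \<inter> ?X = {P_infinity}"
      using assms(2) by (rule line_infinity_Int_conic_union)
    show "\<exists>m\<in>set ?ms. secant m ?X l" if "l \<in> pg_lines" for l
    proof
      show "secant (card (l \<inter> ?X)) ?X l" using that by (simp add: secant_def)
      show "card (l \<inter> ?X) \<in> set ?ms"
        using card_mono[of ?X "l \<inter> ?X"] by (simp add: less_Suc_eq_le del: upt_Suc)
    qed
    show "\<exists>n. \<forall>P\<in>line_infinity - {P_infinity}. card {l. secant m ?X l \<and> P \<in> l} = n" for m
      using card_secants_at_infinity[OF two, where m = m and B = B] by blast
    show "secant (card B + 1) ?X l"
      if "l \<in> pg_lines" "P_infinity \<in> l \<and> l \<noteq> line_infinity" for l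
      using vertical_line_secant[OF assms(2)] that by blast
  qed
  then show ?thesis unfolding regular_of_pointed_type_def by blast
qed

end
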